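(* Let $m,r,s$ be integers with $1\leq r,s\leq m-3$ and $r+s=m-2$. Then every strongly connected digraph $D$ with minimum semi-degree $\delta(D)=\min\{\delta^+(D),\delta^-(D)\}\geq m+1$ contains a subdigraph $T$ isomorphic to a member of $\{ODS(m;r,s),\ IDS(m;r,s),\ OIDS(m;r,s)\}$ such that $D-V(T)$ is strongly connected.
   Context: Digraphs are finite, without loops and without parallel arcs. A digraph is strongly connected if for every ordered pair of vertices $x,y$ there is a directed path from $x$ to $y$. $\delta^+(D)$, $\delta^-(D)$ are the minimum out-degree and minimum in-degree; $D-V(T)$ is the subdigraph induced by $V(D)\setminus V(T)$. For positive integers $r,s$ with $r+s=m-2$: the out-double-star $ODS(m;r,s)$ has vertices $u,v,a_1,\dots,a_r,b_1,\dots,b_s$ (all distinct) and arcs $(u,v)$, $(u,a_i)$ for all $i$, $(v,b_j)$ for all $j$ (two out-stars rooted at $u$ and $v$ joined by the arc $(u,v)$). The in-double-star $IDS(m;r,s)$ has the same vertices and arcs $(u,v)$, $(a_i,u)$, $(b_j,v)$. The out-in-double-star $OIDS(m;r,s)$ has the same vertices and arcs $(u,v)$, $(u,a_i)$, $(b_j,v)$. *)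

theory Defs
  imports "Graph_Theory.Graph_Theory"
begin

definition min_out_degree :: "('a, 'b) pre_digraph \<Rightarrow> nat" where
  "min_out_degree D = Min (out_degree D ` verts D)"

definition min_in_degree :: "('a, 'b) pre_digraph \<Rightarrow> nat" where
  "min_in_degree D = Min (in_degree D ` verts D)"

definition min_semi_degree :: "('a, 'b) pre_digraph \<Rightarrow> nat" where
  "min_semi_degree D = min (min_out_degree D) (min_in_degree D)"

datatype ds_vert = CentreU | CentreV | LeafA nat | LeafB nat

definition ds_verts :: "nat \<Rightarrow> nat \<Rightarrow> ds_vert set" where
  "ds_verts r s = {CentreU, CentreV} \<union> LeafA ` {1..r} \<union> LeafB ` {1..s}"

text \<open>The double stars below have \<open>m = r + s + 2\<close> vertices; since \<open>m\<close> is
  determined by \<open>r\<close> and \<open>s\<close>, it is not a separate argument.\<close>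

lemma card_ds_verts: "card (ds_verts r s) = r + s + 2"
proof -
  have "card (LeafA ` {1..r} \<union> LeafB ` {1..s}) = r + s"
    by (subst card_Un_disjoint) (auto simp: card_image inj_on_def)
  moreover have "ds_verts r s = insert CentreU (insert CentreV (LeafA ` {1..r} \<union> LeafB ` {1..s}))"
    by (auto simp: ds_verts_def)
  ultimately show ?thesis
    by (auto simp: card_insert_if)
qed

definition ODS :: "nat \<Rightarrow> nat \<Rightarrow> (ds_vert, ds_vert \<times> ds_vert) pre_digraph" where
  "ODS r s = \<lparr> verts = ds_verts r s,
     arcs = {(CentreU, CentreV)} \<union> {(CentreU, LeafA i) | i. i \<in> {1..r}}
       \<union> {(CentreV, LeafB j) | j. j \<in> {1..s}},
     tail = fst, head = snd \<rparr>"

definition IDS :: "nat \<Rightarrow> nat \<Rightarrow> (ds_vert, ds_vert \<times> ds_vert) pre_digraph" where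
  "IDS r s = \<lparr> verts = ds_verts r s,
     arcs = {(CentreU, CentreV)} \<union> {(LeafA i, CentreU) | i. i \<in> {1..r}}
       \<union> {(LeafB j, CentreV) | j. j \<in> {1..s}},
     tail = fst, head = snd \<rparr>"

definition OIDS :: "nat \<Rightarrow> nat \<Rightarrow> (ds_vert, ds_vert \<times> ds_vert) pre_digraph" where
  "OIDS r s = \<lparr> verts = ds_verts r s,
     arcs = {(CentreU, CentreV)} \<union> {(CentreU, LeafA i) | i. i \<in> {1..r}}
       \<union> {(LeafB j, CentreV) | j. j \<in> {1..s}},
     tail = fst, head = snd \<rparr>"

end

theory Submission
  imports Defs
begin

text \<open>
  Let \<open>H\<close> be a maximal vertex set such that \<open>D[H]\<close> is strong and \<open>R = V - H\<close> contains a double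
  star. If the star does not fill \<open>R\<close>, let \<open>A\<close> and \<open>B\<close> be the vertices of \<open>R\<close> with an
  in-neighbour, respectively an out-neighbour, in \<open>H\<close>. Adding to \<open>H\<close> a path in \<open>R\<close> from \<open>A\<close>
  to \<open>B\<close> keeps it strong, so by maximality no double star avoids such a path. A vertex outside
  \<open>B\<close> (outside \<open>A\<close>) has all of its at least \<open>m + 1\<close> out-neighbours (in-neighbours) in \<open>R\<close>.
  An arc whose ends keep out/out, in/in or out/in degrees at least \<open>m - 1\<close> yields a double star,
  which settles paths with at most two vertices.

  Otherwise consider the shortest paths \<open>w\<^sub>0, w\<^sub>1, \<dots>\<close>. A vertex outside \<open>B\<close> at distance \<open>k\<close> from
  \<open>A\<close> sends no arcs to the path beyond \<open>w\<^bsub>k+1\<^esub>\<close>, hence has at least \<open>m - 1 - k\<close> out-neighbours off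
  the path, and with equality it sends arcs to all of \<open>w\<^sub>0, \<dots>, w\<^bsub>k+1\<^esub>\<close>. Let \<open>c\<close> be an
  out-neighbour of \<open>w\<^sub>0\<close> off the path. If \<open>c\<close> had more than \<open>m - 2\<close> out-neighbours \<open>d\<close> off the
  path, then, no double star being centred at \<open>(c, d)\<close>, every \<open>d\<close> would send arcs to
  \<open>w\<^sub>0, \<dots>, w\<^sub>3\<close>; rerouting through \<open>c\<close> and one \<open>d\<close> would free the arc \<open>(w\<^sub>1, w\<^sub>2)\<close>, into both
  ends of which all other \<open>d\<close> point. So \<open>c\<close> has exactly \<open>m - 2\<close> out-neighbours off the path and
  sends arcs to \<open>w\<^sub>0, w\<^sub>1, w\<^sub>2\<close>. Hence \<open>w\<^sub>1\<close> may be replaced by any such \<open>c\<close>, and so these vertices,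
  of which there are at least \<open>m\<close>, are pairwise joined in both directions: too many out-neighbours.
\<close>

section \<open>Double stars\<close>

definition spans_copy :: "('c, 'd) pre_digraph \<Rightarrow> ('a \<times> 'a) set \<Rightarrow> 'a set \<Rightarrow> bool" where
  "spans_copy S E M \<longleftrightarrow>
    (\<exists>f. inj_on f (verts S) \<and> f ` verts S = M
      \<and> (\<forall>e\<in>arcs S. (f (tail S e), f (head S e)) \<in> E))"

lemma (in wf_digraph) subgraph_iso_of_spans_copy:
  assumes "nomulti_digraph S" "spans_copy S (arcs_ends G) M" "M \<subseteq> verts G"
  obtains T where "subgraph T G" "verts T = M" "digraph_iso T S"
proof -
  interpret S: nomulti_digraph S by fact
  obtain f where inj: "inj_on f (verts S)" and image: "f ` verts S = M"
      and arcs: "\<And>e. e \<in> arcs S \<Longrightarrow> (f (tail S e), f (head S e)) \<in> arcs_ends G"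
    using assms(2) by (auto simp: spans_copy_def)
  have "\<exists>e'\<in>arcs G. tail G e' = f (tail S e) \<and> head G e' = f (head S e)"
    if "e \<in> arcs S" for e
    using arcs[OF that] by (metis reachableE)
  then obtain g where g: "g e \<in> arcs G" "tail G (g e) = f (tail S e)"
      "head G (g e) = f (head S e)"
    if "e \<in> arcs S" for e by metis
  define h where
    "h = \<lparr>iso_verts = f, iso_arcs = g, iso_head = head G, iso_tail = tail G\<rparr>"
  have "inj_on g (arcs S)"
  proof (rule inj_onI)
    fix e e' assume e: "e \<in> arcs S" "e' \<in> arcs S" "g e = g e'"
    then have "f (tail S e) = f (tail S e')" "f (head S e) = f (head S e')"
      using g by metis+
    then have "arc_to_ends S e = arc_to_ends S e'"
      using e inj by (auto simp: arc_to_ends_def dest: inj_onD)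
    then show "e = e'" using e S.no_multi_arcs by blast
  qed
  then have iso: "S.digraph_isomorphism h"
    using S.wf_digraph_axioms inj g by (auto simp: S.digraph_isomorphism_def h_def)
  have "subgraph (app_iso h S) G"
    using S.wf_digraphI_app_iso[OF iso] wf_digraph_axioms image assms(3) g
    by (intro subgraphI) (auto simp: h_def compatible_def)
  moreover have "verts (app_iso h S) = M" using image by (simp add: h_def)
  moreover have "digraph_iso (app_iso h S) S"
    using iso by (intro digraph_iso_swap[OF S.wf_digraph_axioms]) (unfold digraph_iso_def, blast)
  ultimately show thesis by (rule that)
qed

definition double_star :: "('a \<times> 'a) set \<Rightarrow> nat \<Rightarrow> nat \<Rightarrow> 'a set \<Rightarrow> bool" where
  "double_star E r s M \<longleftrightarrow> (\<exists>S\<in>{ODS r s, IDS r s, OIDS r s}. spans_copy S E M)"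

lemma nomulti_digraph_double_stars:
  assumes "S \<in> {ODS r s, IDS r s, OIDS r s}"
  shows "nomulti_digraph S"
proof -
  consider "S = ODS r s" | "S = IDS r s" | "S = OIDS r s" using assms by blast
  then show ?thesis
    by cases (unfold_locales, auto simp: ODS_def IDS_def OIDS_def ds_verts_def arc_to_ends_def)+
qed

lemma double_star_mono:
  assumes "double_star E r s M" "Restr E M \<subseteq> F"
  shows "double_star F r s M"
proof -
  obtain S f where S: "S \<in> {ODS r s, IDS r s, OIDS r s}"
      and f: "inj_on f (verts S)" "f ` verts S = M"
      and arcs: "\<forall>e\<in>arcs S. (f (tail S e), f (head S e)) \<in> E"
    using assms(1) unfolding double_star_def spans_copy_def by blast
  interpret S: nomulti_digraph S using S by (rule nomulti_digraph_double_stars)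
  have "(f (tail S e), f (head S e)) \<in> F" if "e \<in> arcs S" for e
    using that arcs f(2) assms(2) by auto
  then show ?thesis
    using S f unfolding double_star_def spans_copy_def by blast
qed

lemma card_double_star:
  assumes "double_star E r s M"
  shows "card M = r + s + 2"
proof -
  obtain S f where "S \<in> {ODS r s, IDS r s, OIDS r s}" "inj_on f (verts S)" "f ` verts S = M"
    using assms unfolding double_star_def spans_copy_def by blast
  then have "card M = card (ds_verts r s)"
    by (auto simp: ODS_def IDS_def OIDS_def card_image)
  then show ?thesis by (simp add: card_ds_verts)
qed

definition double_star_leaves :: "('a \<times> 'a) set \<Rightarrow> 'a \<Rightarrow> 'a \<Rightarrow> 'a set \<Rightarrow> 'a set \<Rightarrow> bool" where
  "double_star_leaves E u v X Y \<longleftrightarrow>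
     X \<subseteq> E `` {u} \<and> Y \<subseteq> E `` {v} \<or> X \<subseteq> E\<inverse> `` {u} \<and> Y \<subseteq> E\<inverse> `` {v}
     \<or> X \<subseteq> E `` {u} \<and> Y \<subseteq> E\<inverse> `` {v}"

lemma double_star_leaves_mono:
  assumes "double_star_leaves E u v X Y" "X' \<subseteq> X" "Y' \<subseteq> Y"
  shows "double_star_leaves E u v X' Y'"
  using assms unfolding double_star_leaves_def by (meson subset_trans)

lemma ds_verts_labelling:
  assumes uv: "u \<noteq> v" "{u, v} \<inter> (X \<union> Y) = {}"
    and XY: "finite X" "finite Y" "card X = r" "card Y = s" "X \<inter> Y = {}"
  obtains f where "inj_on f (ds_verts r s)" "f ` ds_verts r s = {u, v} \<union> X \<union> Y"
    "f CentreU = u" "f CentreV = v" "f ` LeafA ` {1..r} = X" "f ` LeafB ` {1..s} = Y"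
proof -
  obtain g where "bij_betw g {1..r} X"
    using ex_bij_betw_nat_finite_1 XY by blast
  then have X: "g ` {1..r} = X" by (simp add: bij_betw_def)
  obtain k where "bij_betw k {1..s} Y"
    using ex_bij_betw_nat_finite_1 XY by blast
  then have Y: "k ` {1..s} = Y" by (simp add: bij_betw_def)
  define f where "f = case_ds_vert u v g k"
  have centres: "f CentreU = u" "f CentreV = v" by (simp_all add: f_def)
  have leaves: "f ` LeafA ` {1..r} = X" "f ` LeafB ` {1..s} = Y"
    unfolding image_image by (simp_all only: f_def ds_vert.case X Y)
  have image: "f ` ds_verts r s = {u, v} \<union> X \<union> Y"
    unfolding ds_verts_def image_Un leaves by (simp add: centres)
  have "card ({u, v} \<union> X \<union> Y) = r + s + 2"
    using uv XY by (simp add: card_Un_disjoint)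
  then have "inj_on f (ds_verts r s)"
    by (intro eq_card_imp_inj_on) (simp_all add: image card_ds_verts, simp add: ds_verts_def)
  then show thesis using image centres leaves by (rule that)
qed

lemma double_star_of_leaves:
  assumes uv: "(u, v) \<in> E" "u \<noteq> v" "{u, v} \<inter> (X \<union> Y) = {}"
    and XY: "finite X" "finite Y" "card X = r" "card Y = s" "X \<inter> Y = {}"
    and leaves: "double_star_leaves E u v X Y"
  shows "double_star E r s ({u, v} \<union> X \<union> Y)"
proof -
  obtain f where inj: "inj_on f (ds_verts r s)" and image: "f ` ds_verts r s = {u, v} \<union> X \<union> Y"
      and f: "f CentreU = u" "f CentreV = v"
        "f ` LeafA ` {1..r} = X" "f ` LeafB ` {1..s} = Y"
    using ds_verts_labelling[OF uv(2,3) XY] .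
  consider (ODS) "X \<subseteq> E `` {u}" "Y \<subseteq> E `` {v}" | (IDS) "X \<subseteq> E\<inverse> `` {u}" "Y \<subseteq> E\<inverse> `` {v}"
    | (OIDS) "X \<subseteq> E `` {u}" "Y \<subseteq> E\<inverse> `` {v}"
    using leaves unfolding double_star_leaves_def by blast
  then have "\<exists>S\<in>{ODS r s, IDS r s, OIDS r s}.
      verts S = ds_verts r s \<and> (\<forall>e\<in>arcs S. (f (tail S e), f (head S e)) \<in> E)"
  proof cases
    case ODS
    then show ?thesis using uv(1) unfolding f(3,4)[symmetric]
      by (intro bexI[of _ "ODS r s"]) (auto simp: ODS_def f(1,2) image_subset_iff)
  next
    case IDS
    then show ?thesis using uv(1) unfolding f(3,4)[symmetric]
      by (intro bexI[of _ "IDS r s"]) (auto simp: IDS_def f(1,2) image_subset_iff)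
  next
    case OIDS
    then show ?thesis using uv(1) unfolding f(3,4)[symmetric]
      by (intro bexI[of _ "OIDS r s"]) (auto simp: OIDS_def f(1,2) image_subset_iff)
  qed
  then show ?thesis
    using inj image unfolding double_star_def spans_copy_def by metis
qed

lemma obtain_disjoint_subsets_with_card:
  assumes "finite X" "r \<le> card X" "s \<le> card Y" "r + s \<le> card (X \<union> Y)"
  obtains X' Y' where "X' \<subseteq> X" "Y' \<subseteq> Y" "X' \<inter> Y' = {}" "card X' = r" "card Y' = s"
proof -
  obtain X' where X': "X' \<subseteq> X" "card X' = r" "s \<le> card (Y - X')"
  proof (cases "r \<le> card (X - Y)")
    case True
    then obtain X' where X': "X' \<subseteq> X - Y" "card X' = r" by (meson obtain_subset_with_card_n)
    then have "Y - X' = Y" by blast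
    with X' assms(3) show thesis by (intro that[of X']) auto
  next
    case False
    then obtain X' where X': "X - Y \<subseteq> X'" "X' \<subseteq> X" "card X' = r"
      using exists_subset_between[of "X - Y" r X] assms(1,2) by auto
    then have "X \<union> Y = X' \<union> (Y - X')" by blast
    then have "r + s \<le> r + card (Y - X')" using assms(4) X'(3) by (metis card_Un_le le_trans)
    with X' show thesis by (intro that[of X']) auto
  qed
  moreover obtain Y' where "Y' \<subseteq> Y - X'" "card Y' = s"
    using X'(3) by (meson obtain_subset_with_card_n)
  ultimately show thesis by (intro that[of X' Y']) auto
qed

definition contains_double_star :: "('a \<times> 'a) set \<Rightarrow> nat \<Rightarrow> nat \<Rightarrow> 'a set \<Rightarrow> bool" where
  "contains_double_star E r s Q \<longleftrightarrow> (\<exists>M\<subseteq>Q. double_star E r s M)"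

lemma contains_double_star_Restr:
  assumes "Q \<subseteq> R"
  shows "contains_double_star (Restr E R) r s Q \<longleftrightarrow> contains_double_star E r s Q"
proof -
  have "double_star (Restr E R) r s M \<longleftrightarrow> double_star E r s M" if "M \<subseteq> R" for M
    using that by (intro iffI; elim double_star_mono) auto
  then show ?thesis using assms unfolding contains_double_star_def by (meson subset_trans)
qed

lemma contains_double_star_at_arc:
  assumes "finite Q" "irrefl E" and uv: "(u, v) \<in> E" "u \<in> Q" "v \<in> Q"
    and XY: "X \<subseteq> Q" "Y \<subseteq> Q" and leaves: "double_star_leaves E u v X Y"
    and card: "r \<le> card (X - {v})" "s \<le> card (Y - {u})"
      "r + s \<le> card (X - {v}) \<or> r + s \<le> card (Y - {u})"
  shows "contains_double_star E r s Q"
proof -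
  have fin: "finite (X - {v})" "finite (Y - {u})"
    using XY \<open>finite Q\<close> by (auto intro: finite_subset)
  then have "card (X - {v}) \<le> card (X - {v} \<union> (Y - {u}))"
    "card (Y - {u}) \<le> card (X - {v} \<union> (Y - {u}))"
    by (auto intro: card_mono)
  then have "r + s \<le> card (X - {v} \<union> (Y - {u}))" using card(3) by linarith
  from obtain_disjoint_subsets_with_card[OF fin(1) card(1,2) this]
  obtain X' Y' where sub: "X' \<subseteq> X - {v}" "Y' \<subseteq> Y - {u}" and disj: "X' \<inter> Y' = {}"
      and card': "card X' = r" "card Y' = s" .
  have "u \<noteq> v" "u \<notin> X" "v \<notin> Y"
    using uv(1) leaves irreflD[OF \<open>irrefl E\<close>] unfolding double_star_leaves_def by blast+
  then have "double_star E r s ({u, v} \<union> X' \<union> Y')"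
    using uv(1) sub disj card' fin
    by (intro double_star_of_leaves double_star_leaves_mono[OF leaves]) (auto intro: finite_subset)
  moreover have "{u, v} \<union> X' \<union> Y' \<subseteq> Q" using uv(2,3) XY sub by blast
  ultimately show ?thesis unfolding contains_double_star_def by blast
qed

section \<open>Paths avoiding a double star\<close>

lemma card_le_card_Diff_add:
  assumes "N \<inter> P \<subseteq> K" "finite K"
  shows "card N \<le> card (N - P) + card K"
proof -
  have "card N \<le> card (N - P) + card (N \<inter> P)" by (metis Un_Diff_Int card_Un_le)
  also have "card (N \<inter> P) \<le> card K" using assms by (simp add: card_mono)
  finally show ?thesis by simp
qed

lemma relpow_segment:
  assumes "\<And>i. i < n \<Longrightarrow> (w i, w (Suc i)) \<in> F" "i \<le> j" "j \<le> n"
  shows "(w i, w j) \<in> F ^^ (j - i)"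
  using assms unfolding relpow_fun_conv by (intro exI[of _ "\<lambda>l. w (i + l)"]) auto

text \<open>A whole digraph has \<open>A = B = {}\<close>; deleting vertices puts their out-neighbours into \<open>A\<close> and
  their in-neighbours into \<open>B\<close>.\<close>

locale entry_exit_digraph =
  fixes R :: "'a set" and F :: "('a \<times> 'a) set" and A B :: "'a set" and r s :: nat
  assumes finite_R: "finite R" and F_subset: "F \<subseteq> R \<times> R" and irrefl: "irrefl F"
    and A_subset: "A \<subseteq> R" and B_subset: "B \<subseteq> R"
    and out_degree: "x \<in> R - B \<Longrightarrow> r + s + 3 \<le> card (F `` {x})"
    and in_degree: "x \<in> R - A \<Longrightarrow> r + s + 3 \<le> card (F\<inverse> `` {x})"
    and r_pos: "1 \<le> r" and s_pos: "1 \<le> s"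
begin

lemma finite_out: "finite (F `` {x})"
  using F_subset finite_R by (auto intro: finite_subset[of _ R])

lemma entry_exit_digraph_Diff:
  "entry_exit_digraph (R - H) (Restr F (R - H)) (A \<union> F `` H - H) (B \<union> F\<inverse> `` H - H) r s"
proof
  show "r + s + 3 \<le> card (Restr F (R - H) `` {x})" if "x \<in> R - H - (B \<union> F\<inverse> `` H - H)" for x
  proof -
    have "Restr F (R - H) `` {x} = F `` {x}" using that F_subset by auto
    then show ?thesis using out_degree that by auto
  qed
  show "r + s + 3 \<le> card ((Restr F (R - H))\<inverse> `` {x})" if "x \<in> R - H - (A \<union> F `` H - H)" for x
  proof -
    have "(Restr F (R - H))\<inverse> `` {x} = F\<inverse> `` {x}" using that F_subset by auto
    then show ?thesis using in_degree that by auto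
  qed
qed (use finite_R A_subset B_subset F_subset irrefl r_pos s_pos in \<open>auto simp: irrefl_on_def\<close>)

lemma contains_double_star_Diff_if_arc:
  assumes Y: "finite Y" "card Y \<le> 2" and uv: "(u, v) \<in> F" "u \<in> R - Y" "v \<in> R - Y"
    and ends: "u \<notin> B \<and> v \<notin> B \<or> u \<notin> A \<and> v \<notin> A \<or> u \<notin> B \<and> v \<notin> A"
  shows "contains_double_star F r s (R - Y)"
proof -
  have out: "r + s < card (F `` {x} - Y)" if "x \<in> R" "x \<notin> B" for x
    using card_le_card_Diff_add[of "F `` {x}" Y Y] out_degree[of x] that Y by simp
  have into: "r + s < card (F\<inverse> `` {x} - Y)" if "x \<in> R" "x \<notin> A" for x
    using card_le_card_Diff_add[of "F\<inverse> `` {x}" Y Y] in_degree[of x] that Y by simp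
  have star: "contains_double_star F r s (R - Y)"
    if "r + s < card (N - Y)" "r + s < card (N' - Y)" "double_star_leaves F u v N N'" for N N'
  proof (rule contains_double_star_at_arc[OF _ irrefl uv])
    show "N - Y \<subseteq> R - Y" "N' - Y \<subseteq> R - Y"
      using that(3) F_subset unfolding double_star_leaves_def by blast+
    show "double_star_leaves F u v (N - Y) (N' - Y)"
      using that(3) by (rule double_star_leaves_mono) auto
    show "r \<le> card (N - Y - {v})" "s \<le> card (N' - Y - {u})"
      "r + s \<le> card (N - Y - {v}) \<or> r + s \<le> card (N' - Y - {u})"
      using that(1,2) by (auto simp: card_Diff_singleton_if)
  qed (use finite_R in auto)
  have "u \<in> R" "v \<in> R" using uv by auto
  then show ?thesis
    using ends out into star[of "F `` {u}" "F `` {v}"] star[of "F\<inverse> `` {u}" "F\<inverse> `` {v}"]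
      star[of "F `` {u}" "F\<inverse> `` {v}"]
    unfolding double_star_leaves_def by blast
qed

lemma contains_double_star_Diff:
  assumes Y: "finite Y" "card Y \<le> 2" "card ((A \<inter> B) \<union> Y) \<le> r + s + 2"
    and x: "x \<in> R - (A \<inter> B) - Y"
  shows "contains_double_star F r s (R - Y)"
proof -
  have fin: "finite ((A \<inter> B) \<union> Y)" using Y A_subset finite_R by (auto intro: finite_subset)
  have neighbour: "\<exists>y\<in>N. y \<notin> (A \<inter> B) \<union> Y" if "r + s + 3 \<le> card N" for N
    using that Y(3) card_mono[OF fin, of N] by fastforce
  consider (no_exit) "x \<notin> B" | (no_entry) "x \<notin> A" using x by blast
  then show ?thesis
  proof cases
    case no_exit
    then obtain y where "(x, y) \<in> F" "y \<notin> (A \<inter> B) \<union> Y"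
      using neighbour[of "F `` {x}"] out_degree x by auto
    then show ?thesis
      using no_exit x Y F_subset by (intro contains_double_star_Diff_if_arc[of Y x y]) auto
  next
    case no_entry
    then obtain y where "(y, x) \<in> F" "y \<notin> (A \<inter> B) \<union> Y"
      using neighbour[of "F\<inverse> `` {x}"] in_degree x by auto
    then show ?thesis
      using no_entry x Y F_subset by (intro contains_double_star_Diff_if_arc[of Y y x]) auto
  qed
qed

definition route :: "nat \<Rightarrow> (nat \<Rightarrow> 'a) \<Rightarrow> bool" where
  "route n w \<longleftrightarrow> w 0 \<in> A \<and> w n \<in> B \<and> (\<forall>i<n. (w i, w (Suc i)) \<in> F)"

lemma route_in_R:
  assumes "route n w"
  shows "w ` {..n} \<subseteq> R"
proof -
  have "w i \<in> R" if "i < n" for i using assms that F_subset by (auto simp: route_def)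
  then show ?thesis using assms B_subset by (auto simp: route_def le_less)
qed

lemma route_relpow:
  assumes "route n w" "i \<le> j" "j \<le> n"
  shows "(w i, w j) \<in> F ^^ (j - i)"
  using assms by (intro relpow_segment[of n]) (auto simp: route_def)

lemma route_via_one:
  assumes "route n w" "2 \<le> n" "(w 0, c) \<in> F" "(c, w 2) \<in> F"
  shows "route n (w(1 := c))"
  using assms by (auto simp: route_def numeral_2_eq_2)

lemma route_via_two:
  assumes "route n w" "3 \<le> n" "(w 0, c) \<in> F" "(c, d) \<in> F" "(d, w 3) \<in> F"
  shows "route n (w(1 := c, 2 := d))"
  using assms by (auto simp: route_def numeral_2_eq_2 numeral_3_eq_3)

end

locale shortest_routes = entry_exit_digraph +
  fixes n :: nat
  assumes disjoint: "A \<inter> B = {}" and n_ge: "2 \<le> n"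
    and shortest: "a \<in> A \<Longrightarrow> b \<in> B \<Longrightarrow> (a, b) \<in> F ^^ k \<Longrightarrow> n \<le> k"
begin

lemma not_exit_if_near_entry:
  assumes "a \<in> A" "(a, x) \<in> F ^^ k" "k < n"
  shows "x \<notin> B"
  using shortest assms by fastforce

lemma route_inj:
  assumes "route n w"
  shows "inj_on w {..n}"
proof (rule linorder_inj_onI')
  fix i j assume ij: "i \<in> {..n}" "j \<in> {..n}" "i < j"
  show "w i \<noteq> w j"
  proof
    assume "w i = w j"
    then have "(w 0, w n) \<in> F ^^ i O F ^^ (n - j)"
      using route_relpow[OF assms, of 0 i] route_relpow[OF assms, of j n] ij by auto
    then have "(w 0, w n) \<in> F ^^ (i + (n - j))" by (simp only: relpow_add)
    then have "n \<le> i + (n - j)" using shortest assms by (auto simp: route_def)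
    then show False using ij by auto
  qed
qed

lemma out_neighbours_on_route:
  assumes "route n w" "a \<in> A" "(a, x) \<in> F ^^ k"
  shows "F `` {x} \<inter> w ` {..n} \<subseteq> w ` {..min n (Suc k)}"
proof
  fix y assume "y \<in> F `` {x} \<inter> w ` {..n}"
  then obtain j where j: "y = w j" "j \<le> n" "(x, w j) \<in> F" by auto
  then have "(a, w n) \<in> F ^^ Suc k O F ^^ (n - j)"
    using route_relpow[OF assms(1), of j n] assms(3) by auto
  then have "(a, w n) \<in> F ^^ (Suc k + (n - j))" by (simp only: relpow_add)
  then have "n \<le> Suc k + (n - j)" using shortest assms(1,2) unfolding route_def by blast
  then show "y \<in> w ` {..min n (Suc k)}" using j by auto
qed

lemma in_neighbours_on_route:
  assumes "route n w" "b \<in> B"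
  shows "F\<inverse> `` {b} \<inter> w ` {..n} \<subseteq> {w (n - 1), w n}"
proof
  fix y assume "y \<in> F\<inverse> `` {b} \<inter> w ` {..n}"
  then obtain j where j: "y = w j" "j \<le> n" "(w j, b) \<in> F" by auto
  then have "(w 0, b) \<in> F ^^ Suc j" using route_relpow[OF assms(1), of 0 j] by auto
  then have "n \<le> Suc j" using shortest assms unfolding route_def by blast
  then have "j = n - 1 \<or> j = n" using j(2) by linarith
  then show "y \<in> {w (n - 1), w n}" using j(1) by auto
qed

lemma out_neighbours_off_route:
  assumes "route n w" "a \<in> A" "(a, x) \<in> F ^^ k" "x \<in> R - B"
  shows "r + s + 1 \<le> card (F `` {x} - w ` {..n}) + k"
proof -
  have "card (w ` {..min n (Suc k)}) \<le> k + 2"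
    using card_image_le[of "{..min n (Suc k)}" w] by simp
  then show ?thesis
    using card_le_card_Diff_add[OF out_neighbours_on_route[OF assms(1-3)]] out_degree[OF assms(4)]
    by simp
qed

lemma route_prefix_subset_out:
  assumes "route n w" "a \<in> A" "(a, x) \<in> F ^^ k" "x \<in> R - B"
    and few: "card (F `` {x} - w ` {..n}) + k \<le> r + s + 1"
  shows "Suc k \<le> n" "w ` {..Suc k} \<subseteq> F `` {x}"
proof -
  let ?on = "F `` {x} \<inter> w ` {..n}"
  note prefix = out_neighbours_on_route[OF assms(1-3)]
  have "card (F `` {x}) = card ?on + card (F `` {x} - w ` {..n})"
    using finite_out by (rule card_Int_Diff)
  then have on: "k + 2 \<le> card ?on" using out_degree[OF assms(4)] few by linarith
  have image: "card (w ` {..min n (Suc k)}) \<le> Suc (min n (Suc k))"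
    using card_image_le[of "{..min n (Suc k)}" w] by simp
  have "card ?on \<le> card (w ` {..min n (Suc k)})" using prefix by (intro card_mono) auto
  with on image show n: "Suc k \<le> n" by linarith
  have "?on = w ` {..min n (Suc k)}"
    using prefix on image by (intro card_seteq) auto
  then show "w ` {..Suc k} \<subseteq> F `` {x}" using n by auto
qed

lemma route_prefix_subset_out_second_layer:
  assumes w: "route n w" and c: "(w 0, c) \<in> F" "card (F `` {c} - w ` {..n}) \<le> r + s"
  shows "w ` {..2} \<subseteq> F `` {c}"
proof -
  have w0: "w 0 \<in> A" "(w 0, c) \<in> F ^^ 1" using w c by (auto simp: route_def)
  have "c \<in> R - B" using c(1) F_subset not_exit_if_near_entry[OF w0] n_ge by auto
  from route_prefix_subset_out(2)[OF w w0 this] show ?thesis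
    using c(2) by (simp add: numeral_2_eq_2)
qed

lemma third_layer_not_exit:
  assumes w: "route n w" and no_star: "\<not> contains_double_star F r s (R - w ` {..n})"
    and c: "(w 0, c) \<in> F" "c \<notin> w ` {..n}" and d: "(c, d) \<in> F" "d \<notin> w ` {..n}"
  shows "d \<in> R - B"
proof -
  let ?P = "w ` {..n}"
  have R: "c \<in> R" "d \<in> R" and w0: "w 0 \<in> A" using w c d F_subset by (auto simp: route_def)
  have "d \<notin> B"
  proof
    assume dB: "d \<in> B"
    have "card {w (n - 1), w n} \<le> 2" by (simp add: card_insert_if)
    moreover have "d \<in> R - A" using R(2) dB disjoint by auto
    ultimately have into: "r + s + 1 \<le> card (F\<inverse> `` {d} - ?P)"
      using card_le_card_Diff_add[OF in_neighbours_on_route[OF w dB]] in_degree[of d] by simp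
    have "c \<notin> B" using not_exit_if_near_entry[OF w0, of c 1] c n_ge by auto
    then have out: "r + s \<le> card (F `` {c} - ?P)"
      using out_neighbours_off_route[OF w w0, of c 1] c R by simp
    have "contains_double_star F r s (R - ?P)"
    proof (rule contains_double_star_at_arc[OF _ irrefl d(1)])
      show "double_star_leaves F c d (F `` {c} - ?P) (F\<inverse> `` {d} - ?P)"
        unfolding double_star_leaves_def by blast
      show "r \<le> card (F `` {c} - ?P - {d})" "s \<le> card (F\<inverse> `` {d} - ?P - {c})"
        "r + s \<le> card (F `` {c} - ?P - {d}) \<or> r + s \<le> card (F\<inverse> `` {d} - ?P - {c})"
        using out into s_pos by (auto simp: card_Diff_singleton_if)
    qed (use finite_R c d R F_subset in auto)
    then show False using no_star by contradiction
  qed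
  then show ?thesis using R(2) by simp
qed

lemma route_prefix_subset_out_third_layer:
  assumes w: "route n w" and no_star: "\<not> contains_double_star F r s (R - w ` {..n})"
    and c: "(w 0, c) \<in> F" "c \<notin> w ` {..n}" and rich: "r + s < card (F `` {c} - w ` {..n})"
    and d: "(c, d) \<in> F" "d \<notin> w ` {..n}"
  shows "3 \<le> n" "w ` {..3} \<subseteq> F `` {d}"
proof -
  let ?P = "w ` {..n}"
  have R: "c \<in> R" "d \<in> R" and w0: "w 0 \<in> A" using w c d F_subset by (auto simp: route_def)
  have "card (F `` {d} - ?P - {c}) < s"
  proof (rule ccontr)
    assume many: "\<not> card (F `` {d} - ?P - {c}) < s"
    have "contains_double_star F r s (R - ?P)"
    proof (rule contains_double_star_at_arc[OF _ irrefl d(1)])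
      show "double_star_leaves F c d (F `` {c} - ?P) (F `` {d} - ?P)"
        unfolding double_star_leaves_def by blast
      show "r \<le> card (F `` {c} - ?P - {d})" "s \<le> card (F `` {d} - ?P - {c})"
        "r + s \<le> card (F `` {c} - ?P - {d}) \<or> r + s \<le> card (F `` {d} - ?P - {c})"
        using rich many by (auto simp: card_Diff_singleton_if)
    qed (use finite_R c d R F_subset in auto)
    then show False using no_star by contradiction
  qed
  then have few: "card (F `` {d} - ?P) \<le> s"
    by (simp add: card_Diff_singleton_if split: if_splits)
  have "(w 0, d) \<in> F ^^ 2" using c d by (auto simp: numeral_2_eq_2)
  note third_layer = w w0 this third_layer_not_exit[OF w no_star c d]
  show "3 \<le> n" "w ` {..3} \<subseteq> F `` {d}"
    using route_prefix_subset_out[OF third_layer] few r_pos by simp_all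
qed

lemma ex_route_avoids_double_star_if_many_out:
  assumes w: "route n w" and c: "(w 0, c) \<in> F" "c \<notin> w ` {..n}"
    and rich: "r + s < card (F `` {c} - w ` {..n})"
  shows "\<exists>w'. route n w' \<and> contains_double_star F r s (R - w' ` {..n})"
proof (cases "contains_double_star F r s (R - w ` {..n})")
  case False
  let ?N = "F `` {c} - w ` {..n}"
  note third_layer = route_prefix_subset_out_third_layer[OF w False c rich]
  have "?N \<noteq> {}" using rich by (metis card.empty not_less_zero)
  then obtain d where d: "d \<in> ?N" by blast
  have "3 \<le> n" using third_layer(1) d by blast
  have onto: "w ` {..3} \<subseteq> F `` {x}" if "x \<in> ?N" for x using third_layer(2) that by blast
  define w' where "w' = w(1 := c, 2 := d)"
  have w': "route n w'"
    using w \<open>3 \<le> n\<close> c d onto[OF d] unfolding w'_def by (intro route_via_two) auto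
  have inj: "w i = w j \<longleftrightarrow> i = j" if "i \<le> n" "j \<le> n" for i j
    using route_inj[OF w] that by (auto simp: inj_on_def)
  have w12: "w 1 \<in> R - w' ` {..n}" "w 2 \<in> R - w' ` {..n}"
    using c d \<open>3 \<le> n\<close> inj[of 1] inj[of 2] route_in_R[OF w] by (auto simp: w'_def)
  have off: "?N - {d} \<subseteq> R - w' ` {..n}"
    using c F_subset irrefl by (auto simp: w'_def irrefl_on_def)
  have "contains_double_star F r s (R - w' ` {..n})"
  proof (rule contains_double_star_at_arc[OF _ irrefl _ w12 off off])
    show "(w 1, w 2) \<in> F" using w \<open>3 \<le> n\<close> by (auto simp: route_def numeral_2_eq_2)
    have "w 1 \<in> w ` {..3}" "w 2 \<in> w ` {..3}" by auto
    then show "double_star_leaves F (w 1) (w 2) (?N - {d}) (?N - {d})"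
      using onto unfolding double_star_leaves_def by blast
    have "w 1 \<in> w ` {..n}" "w 2 \<in> w ` {..n}" using \<open>3 \<le> n\<close> by auto
    then have "?N - {d} - {w 2} = ?N - {d}" "?N - {d} - {w 1} = ?N - {d}" by blast+
    moreover have "r + s \<le> card (?N - {d})" using rich by (auto simp: card_Diff_singleton_if)
    ultimately show "r \<le> card (?N - {d} - {w 2})" "s \<le> card (?N - {d} - {w 1})"
      "r + s \<le> card (?N - {d} - {w 2}) \<or> r + s \<le> card (?N - {d} - {w 1})"
      by simp_all
  qed (use finite_R in auto)
  with w' show ?thesis by blast
qed (use w in blast)

lemma ex_shortest_route_avoids_double_star:
  assumes w: "route n w"
  shows "\<exists>w'. route n w' \<and> contains_double_star F r s (R - w' ` {..n})"
proof (rule ccontr)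
  assume none: "\<not> ?thesis"
  let ?P = "w ` {..n}"
  let ?S = "F `` {w 0} - ?P"
  have few: "card (F `` {c} - u ` {..n}) \<le> r + s"
    if "route n u" "c \<in> F `` {u 0} - u ` {..n}" for u c
    using ex_route_avoids_double_star_if_many_out[OF that(1)] that(2) none
    by (meson DiffE Image_singleton_iff not_le)
  have prefix: "u ` {..2} \<subseteq> F `` {c}"
    if "route n u" "c \<in> F `` {u 0} - u ` {..n}" for u c
    using route_prefix_subset_out_second_layer[OF that(1)] that(2) few[OF that] by auto
  have w0: "w 0 \<in> A" "w 0 \<in> R - B" using w disjoint A_subset by (auto simp: route_def)
  have "F `` {w 0} \<inter> ?P \<subseteq> {w 1}"
    using out_neighbours_on_route[OF w w0(1), of "w 0" 0] irrefl n_ge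
    by (auto simp: irrefl_on_def atMost_Suc min_def)
  then have S: "r + s + 2 \<le> card ?S"
    using card_le_card_Diff_add[of "F `` {w 0}" ?P "{w 1}"] out_degree[OF w0(2)] by simp
  then have "card ?S \<noteq> 0" by linarith
  then obtain c where c: "c \<in> ?S" by (metis card.empty ex_in_conv)
  have "?S - {c} \<subseteq> F `` {c} - ?P"
  proof
    fix c' assume c': "c' \<in> ?S - {c}"
    define w' where "w' = w(1 := c')"
    have "(c', w 2) \<in> F" using prefix[OF w, of c'] c' by auto
    then have w': "route n w'"
      using w c' n_ge unfolding w'_def by (intro route_via_one) auto
    have "c \<in> F `` {w' 0} - w' ` {..n}" using c c' by (auto simp: w'_def)
    moreover have "w' 1 \<in> w' ` {..2}" by auto
    ultimately have "w' 1 \<in> F `` {c}" using prefix[OF w'] by blast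
    then show "c' \<in> F `` {c} - ?P" using c' by (simp add: w'_def)
  qed
  then have "card (?S - {c}) \<le> card (F `` {c} - ?P)"
    using finite_out by (intro card_mono) auto
  also have "\<dots> \<le> r + s" using few[OF w c] .
  finally show False using S c by (simp add: card_Diff_singleton)
qed

end

context entry_exit_digraph
begin

lemma ex_vertex_avoids_double_star:
  assumes meet: "A \<inter> B \<noteq> {}" and M: "double_star F r s M" "M \<subset> R"
  shows "\<exists>z. route 0 (\<lambda>_. z) \<and> contains_double_star F r s (R - {z})"
proof (cases "A \<inter> B \<subseteq> M")
  case True
  obtain z where z: "z \<in> A \<inter> B" using meet by blast
  obtain x where x: "x \<in> R - M" using M by blast
  have "card ((A \<inter> B) \<union> {z}) \<le> card M"
    using True z M(2) finite_R by (intro card_mono) (auto intro: finite_subset)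
  then have "contains_double_star F r s (R - {z})"
    using card_double_star[OF M(1)] x z True by (intro contains_double_star_Diff[of _ x]) auto
  then show ?thesis using z by (auto simp: route_def)
next
  case False
  then obtain z where "z \<in> A \<inter> B" "z \<notin> M" by blast
  then show ?thesis using M by (auto simp: route_def contains_double_star_def)
qed

lemma arc_avoids_double_star:
  assumes disjoint: "A \<inter> B = {}" and w: "route 1 w"
  shows "contains_double_star F r s (R - w ` {..1})"
proof -
  have P: "w ` {..1} = {w 0, w 1}" by (auto simp: atMost_Suc)
  have card: "card {w 0, w 1} \<le> 2" by (simp add: card_insert_if)
  have "w 0 \<in> R - B" using w disjoint A_subset by (auto simp: route_def)
  then have "\<not> F `` {w 0} \<subseteq> {w 0, w 1}"
    using card_mono[of "{w 0, w 1}" "F `` {w 0}"] out_degree[of "w 0"] card by auto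
  then obtain x where "x \<in> F `` {w 0} - {w 0, w 1}" by blast
  then show ?thesis
    unfolding P using disjoint F_subset card r_pos
    by (intro contains_double_star_Diff[of _ x]) auto
qed

lemma ex_route_avoids_double_star:
  assumes conn: "a \<in> A" "b \<in> B" "(a, b) \<in> F\<^sup>*" and M: "double_star F r s M" "M \<subset> R"
  shows "\<exists>n w. route n w \<and> contains_double_star F r s (R - w ` {..n})"
proof (cases "A \<inter> B = {}")
  case False
  then obtain z where "route 0 (\<lambda>_. z)" "contains_double_star F r s (R - {z})"
    using ex_vertex_avoids_double_star M by blast
  then show ?thesis by (intro exI[of _ 0] exI[of _ "\<lambda>_. z"]) simp
next
  case disj: True
  define n where "n = (LEAST n. \<exists>w. route n w)"
  have route_iff: "(\<exists>w. route k w) \<longleftrightarrow> (\<exists>a\<in>A. \<exists>b\<in>B. (a, b) \<in> F ^^ k)" for k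
    unfolding relpow_fun_conv route_def by blast
  have "\<exists>k. \<exists>w. route k w" using conn unfolding route_iff rtrancl_power by blast
  then have "\<exists>w. route n w" unfolding n_def by (rule LeastI_ex)
  then obtain w where w: "route n w" by blast
  have least: "n \<le> k" if "a \<in> A" "b \<in> B" "(a, b) \<in> F ^^ k" for a b k
    unfolding n_def using that route_iff by (intro Least_le) blast
  have "n \<noteq> 0" using w disj by (auto simp: route_def)
  then consider (arc) "n = 1" | (long) "2 \<le> n" by linarith
  then show ?thesis
  proof cases
    case arc
    then show ?thesis using arc_avoids_double_star disj w by blast
  next
    case long
    then interpret shortest_routes R F A B r s n
      using disj least by unfold_locales
    show ?thesis using ex_shortest_route_avoids_double_star[OF w] by blast
  qed
qed

end

section \<open>Strong connectivity\<close>

definition strong_on :: "('a \<times> 'a) set \<Rightarrow> 'a set \<Rightarrow> bool" where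
  "strong_on E X \<longleftrightarrow> X \<noteq> {} \<and> X \<times> X \<subseteq> (Restr E X)\<^sup>*"

lemma strong_on_Un_ear:
  assumes H: "strong_on E H" and h: "h \<in> H" "h' \<in> H" "(h, w 0) \<in> E" "(w n, h') \<in> E"
    and w: "\<And>i. i < n \<Longrightarrow> (w i, w (Suc i)) \<in> E"
  shows "strong_on E (H \<union> w ` {..n})"
proof -
  define F where "F = Restr E (H \<union> w ` {..n})"
  have "(Restr E H)\<^sup>* \<subseteq> F\<^sup>*" by (intro rtrancl_mono) (auto simp: F_def)
  then have within: "(x, y) \<in> F\<^sup>*" if "x \<in> H" "y \<in> H" for x y
    using H that by (auto simp: strong_on_def)
  have along: "(w i, w j) \<in> F\<^sup>*" if "i \<le> j" "j \<le> n" for i j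
  proof -
    have "(w i, w j) \<in> F ^^ (j - i)"
      using that w by (intro relpow_segment[of n]) (auto simp: F_def)
    then show ?thesis by (rule relpow_imp_rtrancl)
  qed
  have "(h, w 0) \<in> F" "(w n, h') \<in> F" using h by (auto simp: F_def)
  then have ear: "(h, w i) \<in> F\<^sup>*" "(w i, h') \<in> F\<^sup>*" if "i \<le> n" for i
    using along[of 0 i] along[of i n] that
    by (auto intro: converse_rtrancl_into_rtrancl rtrancl_into_rtrancl)
  have "(x, y) \<in> F\<^sup>*" if "x \<in> H \<union> w ` {..n}" "y \<in> H \<union> w ` {..n}" for x y
  proof -
    have "(x, h') \<in> F\<^sup>*" using that(1) within[OF _ h(2)] ear(2) by auto
    also have "(h', h) \<in> F\<^sup>*" using within h(1,2) by simp
    also have "(h, y) \<in> F\<^sup>*" using that(2) within[OF h(1)] ear(1) by auto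
    finally show ?thesis .
  qed
  then show ?thesis using h(1) unfolding strong_on_def F_def by blast
qed

lemma rtrancl_last_exit:
  assumes "(h, x) \<in> E\<^sup>*" "h \<in> H" "x \<notin> H"
  shows "\<exists>a\<in>E `` H - H. (a, x) \<in> (Restr E (- H))\<^sup>*"
  using assms(1,3)
proof (induction rule: rtrancl_induct)
  case base
  then show ?case using assms(2) by simp
next
  case (step y z)
  show ?case
  proof (cases "y \<in> H")
    case True
    then show ?thesis using step by blast
  next
    case False
    then obtain a where a: "a \<in> E `` H - H" "(a, y) \<in> (Restr E (- H))\<^sup>*" using step by blast
    have "(y, z) \<in> Restr E (- H)" using step False by auto
    with a show ?thesis by (meson rtrancl_into_rtrancl)
  qed
qed

lemma strong_on_obtain_ear:
  assumes V: "strong_on E V" and H: "H \<noteq> {}" "H \<subset> V"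
  obtains a b where "a \<in> E `` H - H" "b \<in> E\<inverse> `` H - H" "(a, b) \<in> (Restr E (- H))\<^sup>*"
proof -
  obtain h x where hx: "h \<in> H" "x \<in> V" "x \<notin> H" using H by blast
  have "(Restr E V)\<^sup>* \<subseteq> E\<^sup>*" by (intro rtrancl_mono) auto
  then have "(h, x) \<in> E\<^sup>*" "(x, h) \<in> E\<^sup>*" using V H hx by (auto simp: strong_on_def)
  obtain a where a: "a \<in> E `` H - H" "(a, x) \<in> (Restr E (- H))\<^sup>*"
    using rtrancl_last_exit[OF \<open>(h, x) \<in> E\<^sup>*\<close> hx(1,3)] by blast
  have "(h, x) \<in> (E\<inverse>)\<^sup>*" using \<open>(x, h) \<in> E\<^sup>*\<close> by (rule rtrancl_converseI)
  then obtain b where b: "b \<in> E\<inverse> `` H - H" "(b, x) \<in> (Restr (E\<inverse>) (- H))\<^sup>*"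
    using rtrancl_last_exit[OF _ hx(1,3)] by blast
  have "Restr (E\<inverse>) (- H) = (Restr E (- H))\<inverse>" by auto
  with b(2) have "(x, b) \<in> (Restr E (- H))\<^sup>*" by (metis rtrancl_converseD)
  with a b(1) show thesis using that by (meson rtrancl_trans)
qed

lemma strong_on_extend:
  assumes D: "entry_exit_digraph V E {} {} r s" and V: "strong_on E V"
    and H: "strong_on E H" "H \<subseteq> V" and M: "double_star E r s M" "M \<subset> V - H"
  shows "\<exists>H'\<subseteq>V. H \<subset> H' \<and> strong_on E H' \<and> contains_double_star E r s (V - H')"
proof -
  interpret D: entry_exit_digraph V E "{}" "{}" r s by fact
  define R where "R = V - H"
  interpret R: entry_exit_digraph R "Restr E R" "E `` H - H" "E\<inverse> `` H - H" r s
    using D.entry_exit_digraph_Diff[of H] by (simp add: R_def)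
  have "H \<noteq> {}" "H \<subset> V" using H M by (auto simp: strong_on_def)
  then obtain a b where ab: "a \<in> E `` H - H" "b \<in> E\<inverse> `` H - H" "(a, b) \<in> (Restr E (- H))\<^sup>*"
    by (rule strong_on_obtain_ear[OF V])
  have "Restr E (- H) = Restr E R" using D.F_subset by (auto simp: R_def)
  with ab have "(a, b) \<in> (Restr E R)\<^sup>*" by simp
  moreover have "double_star (Restr E R) r s M"
    using M by (intro double_star_mono[OF M(1)]) (auto simp: R_def)
  ultimately obtain n w where w: "R.route n w"
      and star: "contains_double_star (Restr E R) r s (R - w ` {..n})"
    using R.ex_route_avoids_double_star[OF ab(1,2)] M(2) unfolding R_def by blast
  have P: "w ` {..n} \<subseteq> R" by (rule R.route_in_R[OF w])
  have ends: "w 0 \<in> E `` H" "w n \<in> E\<inverse> `` H" and arcs: "\<And>i. i < n \<Longrightarrow> (w i, w (Suc i)) \<in> E"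
    using w by (auto simp: R.route_def)
  then have "strong_on E (H \<union> w ` {..n})" using strong_on_Un_ear[OF H(1)] by blast
  moreover have "V - (H \<union> w ` {..n}) = R - w ` {..n}" by (auto simp: R_def)
  then have "contains_double_star E r s (V - (H \<union> w ` {..n}))"
    using star contains_double_star_Restr[of "R - w ` {..n}" R] by simp
  moreover have "w 0 \<in> R" using P by blast
  then have "H \<union> w ` {..n} \<subseteq> V" "H \<subset> H \<union> w ` {..n}" using P H(2) unfolding R_def by blast+
  ultimately show ?thesis by blast
qed

theorem ex_double_star_strong_on_Diff:
  assumes D: "entry_exit_digraph V E {} {} r s" and V: "strong_on E V"
  shows "\<exists>M\<subseteq>V. double_star E r s M \<and> strong_on E (V - M)"
proof -
  interpret D: entry_exit_digraph V E "{}" "{}" r s by fact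
  define good where
    "good H \<longleftrightarrow> H \<subseteq> V \<and> strong_on E H \<and> contains_double_star E r s (V - H)" for H
  obtain h where h: "h \<in> V" using V by (auto simp: strong_on_def)
  then have "E `` {h} \<noteq> {}" using D.out_degree[of h] by auto
  then obtain x where "x \<in> V - {h}" using D.F_subset D.irrefl by (auto simp: irrefl_on_def)
  then have "contains_double_star E r s (V - {h})"
    by (intro D.contains_double_star_Diff[of _ x]) auto
  then have "good {h}" using h by (auto simp: good_def strong_on_def)
  moreover have "finite {H. good H}"
    using D.finite_R by (auto simp: good_def intro: finite_subset[of _ "Pow V"])
  ultimately obtain H where H: "good H" and maximal: "\<And>H'. good H' \<Longrightarrow> H \<subseteq> H' \<Longrightarrow> H = H'"
    using finite_has_maximal[of "{H. good H}"] by blast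
  obtain M where M: "M \<subseteq> V - H" "double_star E r s M"
    using H by (auto simp: good_def contains_double_star_def)
  have "M = V - H"
  proof (rule ccontr)
    assume "M \<noteq> V - H"
    then have "M \<subset> V - H" using M(1) by blast
    with strong_on_extend[OF D V _ _ M(2)] H obtain H' where "good H'" "H \<subset> H'"
      unfolding good_def by metis
    then show False using maximal by blast
  qed
  then have "V - M = H" using H by (auto simp: good_def)
  then show ?thesis using H M by (auto simp: good_def)
qed

lemma (in wf_digraph) strongly_connected_iff_strong_on:
  "strongly_connected G \<longleftrightarrow> strong_on (arcs_ends G) (verts G)"
proof -
  have "arcs_ends G \<subseteq> verts G \<times> verts G" by (auto simp: arcs_ends_conv)
  then have "Restr (arcs_ends G) (verts G) = arcs_ends G" by blast
  moreover have "u \<rightarrow>\<^sup>* v \<longleftrightarrow> (u, v) \<in> (arcs_ends G)\<^sup>*" if "u \<in> verts G" "v \<in> verts G" for u v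
    using that unfolding reachable_def
    by (meson adj_in_verts(2) rtrancl_consistent_rtrancl_on rtrancl_on_rtranclI)
  ultimately show ?thesis by (auto simp: strongly_connected_def strong_on_def)
qed

lemma (in wf_digraph) strongly_connected_induce_iff_strong_on:
  "strongly_connected (G \<restriction> X) \<longleftrightarrow> strong_on (arcs_ends G) X"
proof -
  have "arcs_ends (G \<restriction> X) = Restr (arcs_ends G) X" by (auto simp: arcs_ends_conv)
  then show ?thesis
    using wf_digraph.strongly_connected_iff_strong_on[OF wellformed_induce_subgraph, of X]
    by (simp add: strong_on_def)
qed

context digraph
begin

lemma card_arcs_ends_Image: "card (arcs_ends G `` {v}) = out_degree G v"
proof -
  have "arcs_ends G `` {v} = head G ` out_arcs G v"
    by (auto simp: arcs_ends_conv out_arcs_def)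
  moreover have "inj_on (head G) (out_arcs G v)"
    using no_multi_arcs by (auto simp: inj_on_def out_arcs_def arc_to_ends_def)
  ultimately show ?thesis by (simp add: out_degree_def card_image)
qed

lemma card_arcs_ends_converse_Image: "card ((arcs_ends G)\<inverse> `` {v}) = in_degree G v"
proof -
  have "(arcs_ends G)\<inverse> `` {v} = tail G ` in_arcs G v"
    by (auto simp: arcs_ends_conv in_arcs_def)
  moreover have "inj_on (tail G) (in_arcs G v)"
    using no_multi_arcs by (auto simp: inj_on_def in_arcs_def arc_to_ends_def)
  ultimately show ?thesis by (simp add: in_degree_def card_image)
qed

lemma min_semi_degree_le:
  assumes "v \<in> verts G"
  shows "min_semi_degree G \<le> out_degree G v" "min_semi_degree G \<le> in_degree G v"
proof -
  have "min_out_degree G \<le> out_degree G v" "min_in_degree G \<le> in_degree G v"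
    using assms by (auto simp: min_out_degree_def min_in_degree_def)
  then show "min_semi_degree G \<le> out_degree G v" "min_semi_degree G \<le> in_degree G v"
    by (auto simp: min_semi_degree_def)
qed

lemma entry_exit_digraph_if_min_semi_degree:
  assumes "1 \<le> r" "1 \<le> s" "r + s + 3 \<le> min_semi_degree G"
  shows "entry_exit_digraph (verts G) (arcs_ends G) {} {} r s"
proof
  show "r + s + 3 \<le> card (arcs_ends G `` {x})" if "x \<in> verts G - {}" for x
    using assms(3) min_semi_degree_le that by (fastforce simp: card_arcs_ends_Image)
  show "r + s + 3 \<le> card ((arcs_ends G)\<inverse> `` {x})" if "x \<in> verts G - {}" for x
    using assms(3) min_semi_degree_le that by (fastforce simp: card_arcs_ends_converse_Image)
qed (use assms no_loops in \<open>auto simp: irrefl_on_def arcs_ends_conv\<close>)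

end

theorem theorem4p4:
  fixes D :: "('a, 'b) pre_digraph" and m r s :: nat
  assumes "1 \<le> r" and "r \<le> m - 3" and "1 \<le> s" and "s \<le> m - 3" and "r + s = m - 2"
    and "digraph D" and "strongly_connected D"
    and "min_semi_degree D \<ge> m + 1"
  shows "\<exists>T. subgraph T D \<and> (\<exists>S \<in> {ODS r s, IDS r s, OIDS r s}. digraph_iso T S)
           \<and> strongly_connected (D \<restriction> (verts D - verts T))"
proof -
  interpret digraph D by fact
  have "m + 1 = r + s + 3" using assms(1-5) by linarith
  then have "entry_exit_digraph (verts D) (arcs_ends D) {} {} r s"
    using assms by (intro entry_exit_digraph_if_min_semi_degree) auto
  moreover have "strong_on (arcs_ends D) (verts D)"
    using \<open>strongly_connected D\<close> by (simp add: strongly_connected_iff_strong_on)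
  ultimately obtain M where M: "M \<subseteq> verts D" "double_star (arcs_ends D) r s M"
      and rest: "strong_on (arcs_ends D) (verts D - M)"
    using ex_double_star_strong_on_Diff by blast
  obtain S where S: "S \<in> {ODS r s, IDS r s, OIDS r s}" "spans_copy S (arcs_ends D) M"
    using M(2) unfolding double_star_def by blast
  obtain T where "subgraph T D" "verts T = M" "digraph_iso T S"
    using subgraph_iso_of_spans_copy nomulti_digraph_double_stars S M(1) by metis
  then show ?thesis
    using S(1) rest by (auto simp: strongly_connected_induce_iff_strong_on)
qed

end
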